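(* Let $n \geq 1$ be an integer. If $(\mathcal{A}, \mathcal{B})$ is a recovering pair over $[n] = \{1,\dots,n\}$, then $$|\mathcal{A}|\,|\mathcal{B}| \leq 2.2543^n.$$
   Context: For a set $X$, let $2^X$ denote the family of all subsets of $X$. Given two families $\mathcal{A}, \mathcal{B} \subseteq 2^X$, the pair $(\mathcal{A}, \mathcal{B})$ is a recovering pair over $X$ if for all $A, A' \in \mathcal{A}$ and all $B, B' \in \mathcal{B}$: $A \setminus B = A' \setminus B'$ implies $A = A'$, and $B \setminus A = B' \setminus A'$ implies $B = B'$. *)

theory Defs
  imports Complex_Main
begin

definition recovering_pair :: "'a set \<Rightarrow> 'a set set \<Rightarrow> 'a set set \<Rightarrow> bool" where
  "recovering_pair X \<A> \<B> \<longleftrightarrow>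
     \<A> \<subseteq> Pow X \<and> \<B> \<subseteq> Pow X \<and>
     (\<forall>A\<in>\<A>. \<forall>A'\<in>\<A>. \<forall>B\<in>\<B>. \<forall>B'\<in>\<B>.
        (A - B = A' - B' \<longrightarrow> A = A') \<and> (B - A = B' - A' \<longrightarrow> B = B'))"

end

theory Submission
  imports Defs
begin

text \<open>
  Let \<open>A\<close> and \<open>B\<close> be independent and uniform on the two families, with \<open>p\<^sub>i = P(i \<in> A)\<close> and
  \<open>q\<^sub>i = P(i \<in> B)\<close>. Since \<open>A - B\<close> determines \<open>A\<close>, its entropy is \<open>H(A)\<close> plus the average over \<open>A\<close> of
  the entropy of the trace \<open>B \<inter> A\<close>. The trace entropies \<open>H(A \<inter> S)\<close> and \<open>H(B \<inter> S)\<close> are submodular in \<open>S\<close>;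
  take points \<open>x\<close>, \<open>y\<close> of their base polytopes. Then the average is at least the sum of the \<open>p\<^sub>i y\<^sub>i\<close>.
  In the other direction, revealing \<open>A \<inter> D\<close> first gives, for every set \<open>D\<close>,
  \<open>H(A - B) \<le> H(A \<inter> D) + (\<Sum>i\<in>D. p\<^sub>i h(q\<^sub>i)) + (\<Sum>i\<notin>D. h(p\<^sub>i (1 - q\<^sub>i)))\<close>.
  The greedy choice of \<open>x\<close> is tight on all upper level sets of \<open>q\<close>, so these inequalities can be averaged
  over such \<open>D\<close>, the index \<open>i\<close> being covered with weight \<open>s\<^sub>i = max(0, 10 q\<^sub>i - 3)\<close> out of 10; this weight makes
  the coefficient of \<open>x\<^sub>i\<close> vanish once \<open>q\<^sub>i \<ge> 3/10\<close>. Adding the inequality with the roles of \<open>A\<close> and \<open>B\<close>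
  exchanged bounds \<open>13 (H(A) + H(B))\<close> by a sum over \<open>i\<close> of an explicit function of \<open>(p\<^sub>i, q\<^sub>i)\<close>, which is at
  most \<open>15.24 < 13 log\<^sub>2 2.2543\<close> on the unit square.
\<close>

section \<open>Entropy of functions on a finite uniform space\<close>

text \<open>The entropy is the average of \<open>log 2 (|\<Omega>| / |fibre|)\<close> over points of \<open>\<Omega>\<close> rather than over values of
  \<open>f\<close>, so that no term \<open>0 log 0\<close> can occur.\<close>

definition uent :: "'w set \<Rightarrow> ('w \<Rightarrow> 'v) \<Rightarrow> real" where
  "uent \<Omega> f = log 2 (card \<Omega>) - (\<Sum>w\<in>\<Omega>. log 2 (card {v\<in>\<Omega>. f v = f w})) / card \<Omega>"

text \<open>Binary entropy in bits. The factors \<open>x\<close> and \<open>1 - x\<close> give the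
  value 0 at both ends, whatever \<open>log 2 0\<close> is.\<close>

definition bent :: "real \<Rightarrow> real" where
  "bent x = - x * log 2 x - (1 - x) * log 2 (1 - x)"

text \<open>Entropy sees only the partition into fibres, so \<open>f\<close> and \<open>g\<close>
  may have different value types. This lets a tuple be replaced by another encoding of the same
  information.\<close>

lemma uent_cong:
  assumes "\<And>v w. v \<in> \<Omega> \<Longrightarrow> w \<in> \<Omega> \<Longrightarrow> f v = f w \<longleftrightarrow> g v = g w"
  shows "uent \<Omega> f = uent \<Omega> g"
proof -
  have "{v\<in>\<Omega>. f v = f w} = {v\<in>\<Omega>. g v = g w}" if "w \<in> \<Omega>" for w
    using assms that by blast
  then show ?thesis by (simp add: uent_def)
qed

lemma uent_const: "uent \<Omega> (\<lambda>_. c) = 0"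
proof (cases "card \<Omega> = 0")
  case True
  \<comment> \<open>For empty or infinite \<open>\<Omega>\<close> the averaged term is 0 by
    convention, and so is \<open>log 2 0\<close>.\<close>
  then show ?thesis by (auto simp: uent_def log_def card_eq_0_iff)
qed (simp add: uent_def)

lemma uent_inj_on:
  assumes "inj_on f \<Omega>"
  shows "uent \<Omega> f = log 2 (card \<Omega>)"
proof -
  have "{v\<in>\<Omega>. f v = f w} = {w}" if "w \<in> \<Omega>" for w
    using assms that by (auto dest: inj_onD)
  then show ?thesis by (simp add: uent_def)
qed

text \<open>This is nonnegativity of the mutual information of \<open>f\<close> and \<open>g\<close>
  given \<open>k\<close>: \<open>ln z \<le> z - 1\<close> is applied to the ratio
  \<open>Nf * Ng / (N * Nk)\<close>, whose average over \<open>\<Omega>\<close> is at most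
  1.\<close>

lemma uent_submodular:
  assumes fin: "finite \<Omega>"
  shows "uent \<Omega> (\<lambda>w. (f w, g w, k w)) + uent \<Omega> k
       \<le> uent \<Omega> (\<lambda>w. (f w, k w)) + uent \<Omega> (\<lambda>w. (g w, k w))"
proof (cases "\<Omega> = {}")
  case False
  define N where "N = (\<lambda>w. real (card {v\<in>\<Omega>. f v = f w \<and> g v = g w \<and> k v = k w}))"
  define Nf where "Nf = (\<lambda>w. real (card {v\<in>\<Omega>. f v = f w \<and> k v = k w}))"
  define Ng where "Ng = (\<lambda>w. real (card {v\<in>\<Omega>. g v = g w \<and> k v = k w}))"
  define Nk where "Nk = (\<lambda>w. real (card {v\<in>\<Omega>. k v = k w}))"
  have pos: "N w > 0" "Nf w > 0" "Ng w > 0" "Nk w > 0" if "w \<in> \<Omega>" for w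
    using that fin by (auto simp: N_def Nf_def Ng_def Nk_def card_gt_0_iff)
  have term_le: "log 2 (Nf w) + log 2 (Ng w) - log 2 (N w) - log 2 (Nk w)
      \<le> (Nf w * Ng w / (N w * Nk w) - 1) / ln 2" if "w \<in> \<Omega>" for w
  proof -
    note P = pos[OF that]
    have "log 2 (Nf w) + log 2 (Ng w) - log 2 (N w) - log 2 (Nk w)
        = ln (Nf w * Ng w / (N w * Nk w)) / ln 2"
      using P by (simp add: log_def ln_mult ln_div field_simps)
    also have "\<dots> \<le> (Nf w * Ng w / (N w * Nk w) - 1) / ln 2"
      using P by (intro divide_right_mono ln_le_minus_one) auto
    finally show ?thesis .
  qed
  have ratio: "(\<Sum>w\<in>\<Omega>. Nf w * Ng w / (N w * Nk w)) \<le> card \<Omega>"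
  proof -
    define h where "h = (\<lambda>w. (f w, g w, k w))"
    define F where "F = (\<lambda>(a, b, c). real (card {v\<in>\<Omega>. f v = a \<and> k v = c}) *
        real (card {v\<in>\<Omega>. g v = b \<and> k v = c}) / real (card {v\<in>\<Omega>. k v = c}))"
    have Fh: "F (h w) = Nf w * Ng w / Nk w" for w
      by (simp add: F_def h_def Nf_def Ng_def Nk_def)
    \<comment> \<open>The fibre of \<open>h\<close> through \<open>u\<close> has \<open>N u\<close>
      points, which cancels the \<open>N\<close> in the denominator.\<close>
    have fibre_sum: "(\<Sum>w\<in>{w\<in>\<Omega>. h w = t}. Nf w * Ng w / (N w * Nk w)) = F t" if t: "t \<in> h ` \<Omega>" for t
    proof -
      obtain u where u: "u \<in> \<Omega>" "h u = t" using t by blast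
      have "Nf w * Ng w / (N w * Nk w) = F t / N u" if "w \<in> \<Omega>" "h w = t" for w
      proof -
        have "h w = h u" using that u by simp
        then have "N w = N u" by (simp add: N_def h_def)
        then show ?thesis using that(2) Fh[of w] by (simp add: field_simps)
      qed
      then have "(\<Sum>w\<in>{w\<in>\<Omega>. h w = t}. Nf w * Ng w / (N w * Nk w))
          = real (card {w\<in>\<Omega>. h w = t}) * (F t / N u)"
        by simp
      also have "real (card {w\<in>\<Omega>. h w = t}) = N u"
        by (simp add: N_def h_def u(2)[symmetric])
      finally show ?thesis using pos(1)[OF u(1)] by simp
    qed
    have "(\<Sum>w\<in>\<Omega>. Nf w * Ng w / (N w * Nk w))
        = (\<Sum>t\<in>h ` \<Omega>. \<Sum>w\<in>{w\<in>\<Omega>. h w = t}. Nf w * Ng w / (N w * Nk w))"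
      by (rule sum.image_gen[OF fin])
    also have "\<dots> = (\<Sum>t\<in>h ` \<Omega>. F t)"
      using fibre_sum by simp
    \<comment> \<open>Passing from the triples that occur to the full product only adds nonnegative
      terms; there the sums over \<open>a\<close> and \<open>b\<close> separate once
      \<open>c\<close> is fixed.\<close>
    also have "\<dots> \<le> (\<Sum>t\<in>(f ` \<Omega>) \<times> (g ` \<Omega>) \<times> (k ` \<Omega>). F t)"
      using fin by (intro sum_mono2) (auto simp: h_def F_def)
    also have "\<dots> = (\<Sum>a\<in>f ` \<Omega>. \<Sum>b\<in>g ` \<Omega>. \<Sum>c\<in>k ` \<Omega>. F (a, b, c))"
      by (simp add: sum.cartesian_product)
    also have "\<dots> = (\<Sum>a\<in>f ` \<Omega>. \<Sum>c\<in>k ` \<Omega>. \<Sum>b\<in>g ` \<Omega>. F (a, b, c))"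
      by (intro sum.cong refl sum.swap)
    also have "\<dots> = (\<Sum>c\<in>k ` \<Omega>. \<Sum>a\<in>f ` \<Omega>. \<Sum>b\<in>g ` \<Omega>. F (a, b, c))"
      by (rule sum.swap)
    also have "\<dots> = (\<Sum>c\<in>k ` \<Omega>. real (card {v\<in>\<Omega>. k v = c}))"
    proof (rule sum.cong[OF refl])
      fix c assume "c \<in> k ` \<Omega>"
      have marg: "(\<Sum>a\<in>e ` \<Omega>. real (card {v\<in>\<Omega>. e v = a \<and> k v = c})) = real (card {v\<in>\<Omega>. k v = c})"
        for e :: "'a \<Rightarrow> 'z"
      proof -
        have "card {v\<in>\<Omega>. k v = c} = (\<Sum>v\<in>{v\<in>\<Omega>. k v = c}. 1)" by simp
        also have "\<dots> = (\<Sum>a\<in>e ` \<Omega>. \<Sum>v\<in>{v \<in> {v\<in>\<Omega>. k v = c}. e v = a}. 1)"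
          using fin by (intro sum.group[symmetric]) auto
        also have "\<dots> = (\<Sum>a\<in>e ` \<Omega>. card {v\<in>\<Omega>. e v = a \<and> k v = c})"
          by (intro sum.cong) (auto intro: arg_cong[where f = card])
        finally show ?thesis by simp
      qed
      let ?n = "real (card {v\<in>\<Omega>. k v = c})"
      have "(\<Sum>a\<in>f ` \<Omega>. \<Sum>b\<in>g ` \<Omega>. F (a, b, c))
          = (\<Sum>a\<in>f ` \<Omega>. real (card {v\<in>\<Omega>. f v = a \<and> k v = c})) *
            (\<Sum>b\<in>g ` \<Omega>. real (card {v\<in>\<Omega>. g v = b \<and> k v = c})) / ?n"
        by (simp add: F_def sum_product sum_divide_distrib)
      then show "(\<Sum>a\<in>f ` \<Omega>. \<Sum>b\<in>g ` \<Omega>. F (a, b, c)) = ?n"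
        unfolding marg by simp
    qed
    also have "\<dots> = real (card \<Omega>)"
    proof -
      have "card \<Omega> = (\<Sum>v\<in>\<Omega>. 1)" by simp
      also have "\<dots> = (\<Sum>c\<in>k ` \<Omega>. card {v\<in>\<Omega>. k v = c})"
        by (subst sum.image_gen[OF fin, of _ k]) simp
      finally show ?thesis by simp
    qed
    finally show ?thesis .
  qed
  have "(\<Sum>w\<in>\<Omega>. log 2 (Nf w) + log 2 (Ng w) - log 2 (N w) - log 2 (Nk w))
      \<le> (\<Sum>w\<in>\<Omega>. (Nf w * Ng w / (N w * Nk w) - 1) / ln 2)"
    by (rule sum_mono) (rule term_le)
  also have "\<dots> = ((\<Sum>w\<in>\<Omega>. Nf w * Ng w / (N w * Nk w)) - card \<Omega>) / ln 2"
    by (simp add: sum_divide_distrib[symmetric] sum_subtractf)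
  also have "\<dots> \<le> 0"
    using ratio by (simp add: divide_le_0_iff)
  finally have "(\<Sum>w\<in>\<Omega>. log 2 (Nf w)) + (\<Sum>w\<in>\<Omega>. log 2 (Ng w))
      \<le> (\<Sum>w\<in>\<Omega>. log 2 (N w)) + (\<Sum>w\<in>\<Omega>. log 2 (Nk w))"
    by (simp add: sum.distrib sum_subtractf)
  from divide_right_mono[OF this, of "real (card \<Omega>)"] show ?thesis
    by (simp add: uent_def N_def Nf_def Ng_def Nk_def add_divide_distrib)
qed (simp add: uent_def)

lemma uent_pred:
  assumes fin: "finite \<Omega>" and ne: "\<Omega> \<noteq> {}"
  shows "uent \<Omega> P = bent (card {w\<in>\<Omega>. P w} / card \<Omega>)"
proof -
  define M a where "M = real (card \<Omega>)" and "a = real (card {w\<in>\<Omega>. P w})"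
  have M: "M > 0" using fin ne by (simp add: M_def card_gt_0_iff)
  have split: "\<Omega> = {w\<in>\<Omega>. P w} \<union> {w\<in>\<Omega>. \<not> P w}" by blast
  have "card \<Omega> = card {w\<in>\<Omega>. P w} + card {w\<in>\<Omega>. \<not> P w}"
    by (subst split, rule card_Un_disjoint) (use fin in auto)
  then have b: "real (card {w\<in>\<Omega>. \<not> P w}) = M - a"
    by (simp add: M_def a_def)
  have ab: "0 \<le> a" "a \<le> M" using b by (auto simp: a_def)
  have "(\<Sum>w\<in>\<Omega>. log 2 (card {v\<in>\<Omega>. P v = P w}))
      = (\<Sum>w\<in>{w\<in>\<Omega>. P w}. log 2 (card {v\<in>\<Omega>. P v = P w})) +
        (\<Sum>w\<in>{w\<in>\<Omega>. \<not> P w}. log 2 (card {v\<in>\<Omega>. P v = P w}))"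
    by (subst (1) split, rule sum.union_disjoint) (use fin in auto)
  also have "\<dots> = a * log 2 a + (M - a) * log 2 (M - a)"
    by (simp add: a_def[symmetric] b[symmetric])
  finally have "uent \<Omega> P = log 2 M - (a * log 2 a + (M - a) * log 2 (M - a)) / M"
    by (simp add: uent_def M_def)
  also have "\<dots> = bent (a / M)"
  proof -
    have "x / M * log 2 (x / M) = x / M * log 2 x - x / M * log 2 M" if "x \<ge> 0" for x
      using that M by (cases "x = 0") (simp_all add: log_divide algebra_simps)
    from this[of a] this[of "M - a"] ab have
      "bent (a / M) = - (a / M * log 2 a - a / M * log 2 M) - ((M - a) / M * log 2 (M - a) - (M - a) / M * log 2 M)"
      using M by (simp add: bent_def diff_divide_distrib)
    then show ?thesis using M by (simp only:) (simp add: field_simps)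
  qed
  finally show ?thesis by (simp add: M_def a_def)
qed

section \<open>Bases of submodular functions\<close>

text \<open>Edmonds' greedy algorithm, adding the elements in order of decreasing \<open>s\<close>.\<close>

lemma greedy_base:
  fixes \<phi> :: "'a set \<Rightarrow> real" and s :: "'a \<Rightarrow> real"
  assumes "finite I" and zero: "\<phi> {} = 0"
    and sub: "\<And>i S T. S \<subseteq> T \<Longrightarrow> \<phi> (insert i T) + \<phi> S \<le> \<phi> (insert i S) + \<phi> T"
  obtains x where "\<And>S. S \<subseteq> I \<Longrightarrow> sum x S \<le> \<phi> S"
    and "\<And>t. sum x {i\<in>I. t \<le> s i} = \<phi> {i\<in>I. t \<le> s i}" and "sum x I = \<phi> I"
proof -
  have "\<exists>x. (\<forall>S\<subseteq>I. sum x S \<le> \<phi> S) \<and> (\<forall>t. sum x {i\<in>I. t \<le> s i} = \<phi> {i\<in>I. t \<le> s i}) \<and> sum x I = \<phi> I"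
    using \<open>finite I\<close>
  \<comment> \<open>Ranking by \<open>- s\<close> means that each new \<open>z\<close> has the least
    value of \<open>s\<close> so far.\<close>
  proof (induction I rule: finite_ranking_induct[where f = "\<lambda>i. - s i"])
    case empty
    then show ?case by (auto simp: zero)
  next
    case (insert z I)
    show ?case
    proof (cases "z \<in> I")
      case True
      then show ?thesis using insert.IH by (simp add: insert_absorb)
    next
      case False
      from insert.IH obtain x where x: "\<And>S. S \<subseteq> I \<Longrightarrow> sum x S \<le> \<phi> S"
        "\<And>t. sum x {i\<in>I. t \<le> s i} = \<phi> {i\<in>I. t \<le> s i}" "sum x I = \<phi> I"
        by blast
      \<comment> \<open>The new coordinate is the marginal value of \<open>z\<close> over everything
        inserted before it.\<close>
      define y where "y = x(z := \<phi> (insert z I) - \<phi> I)"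
      have y_eq: "sum y S = sum x S" if "S \<subseteq> I" for S
        using that False by (intro sum.cong) (auto simp: y_def)
      have y_insert: "sum y (insert z S) = sum x S + (\<phi> (insert z I) - \<phi> I)" if "S \<subseteq> I" for S
      proof -
        have "z \<notin> S" "finite S" using that False insert.hyps finite_subset by auto
        then have "sum y (insert z S) = sum y S + y z" by simp
        then show ?thesis using y_eq[OF that] by (simp add: y_def)
      qed
      have total: "sum y (insert z I) = \<phi> (insert z I)"
        using y_insert[of I] x(3) by simp
      have "sum y S \<le> \<phi> S" if "S \<subseteq> insert z I" for S
      proof (cases "z \<in> S")
        case True
        then have S: "S = insert z (S - {z})" "S - {z} \<subseteq> I" using that by auto
        \<comment> \<open>Diminishing returns: the marginal value of \<open>z\<close> over
          \<open>I\<close> is at most the one over \<open>S - {z}\<close>.\<close>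
        show ?thesis
          using y_insert[OF S(2)] x(1)[OF S(2)] sub[OF S(2), of z] S(1) by simp
      next
        case False
        then have "S \<subseteq> I" using that by auto
        then show ?thesis using x(1) y_eq by simp
      qed
      \<comment> \<open>As \<open>s z\<close> is least, a level set containing \<open>z\<close> is
        the whole set; any other is a level set of \<open>I\<close>.\<close>
      moreover have "sum y {i \<in> insert z I. t \<le> s i} = \<phi> {i \<in> insert z I. t \<le> s i}" for t
      proof (cases "t \<le> s z")
        case True
        then have "{i \<in> insert z I. t \<le> s i} = insert z I"
          using insert.hyps by fastforce
        then show ?thesis using total by simp
      next
        case False
        then have "{i \<in> insert z I. t \<le> s i} = {i \<in> I. t \<le> s i}" by auto
        then show ?thesis using x(2)[of t] y_eq[of "{i \<in> I. t \<le> s i}"] by auto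
      qed
      ultimately show ?thesis using total by blast
    qed
  qed
  then show ?thesis using that by blast
qed

text \<open>The right-hand side is the integral over \<open>t \<in> [0, L]\<close> of the sums of \<open>d\<close> over the sets \<open>{i. t \<le> s i}\<close>.\<close>

lemma layered_sum_ge:
  fixes d s :: "'a \<Rightarrow> real"
  assumes "finite I" and "c \<le> 0"
    and "\<And>t. c \<le> sum d {i\<in>I. t \<le> s i}"
    and "\<And>i. i \<in> I \<Longrightarrow> 0 \<le> s i \<and> s i \<le> L" and "0 \<le> L"
  shows "L * c \<le> (\<Sum>i\<in>I. s i * d i)"
  using assms
proof (induction "card I" arbitrary: I s L rule: less_induct)
  case less
  show ?case
  proof (cases "I = {}")
    case True
    then show ?thesis using less.prems by (simp add: mult_nonneg_nonpos)
  next
    case False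
    \<comment> \<open>Peel off the lowest layer: up to height \<open>m\<close> the level set is all
      of \<open>I\<close>; above it only \<open>J\<close> matters, with \<open>s\<close> lowered by
      \<open>m\<close>.\<close>
    define m where "m = Min (s ` I)"
    have m_le: "m \<le> s i" if "i \<in> I" for i
      using that less.prems(1) by (simp add: m_def)
    have "m \<in> s ` I" unfolding m_def using less.prems(1) False by (intro Min_in) auto
    then obtain z where z: "z \<in> I" "s z = m" by auto
    define J where "J = {i\<in>I. m < s i}"
    have "J \<subset> I" using z by (auto simp: J_def)
    then have card: "card J < card I" using less.prems(1) psubset_card_mono by blast
    have finJ: "finite J" using less.prems(1) by (simp add: J_def)
    have lev: "c \<le> sum d {i\<in>J. t \<le> s i - m}" for t
    proof (cases "0 < t")
      case True
      then have "{i\<in>J. t \<le> s i - m} = {i\<in>I. t + m \<le> s i}" by (auto simp: J_def)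
      then show ?thesis using less.prems(3) by simp
    next
      case False
      \<comment> \<open>Here the level set is all of \<open>J\<close>. It is either empty, where
        \<open>c \<le> 0\<close> is used, or the level set of \<open>I\<close> at the least value of
        \<open>s\<close> on \<open>J\<close>.\<close>
      then have J: "{i\<in>J. t \<le> s i - m} = J" by (auto simp: J_def)
      show ?thesis
      proof (cases "J = {}")
        case True
        then show ?thesis using J less.prems(2) by simp
      next
        case False
        define u where "u = Min (s ` J)"
        have "u \<in> s ` J" unfolding u_def using finJ False by (intro Min_in) auto
        then have "u > m" by (auto simp: J_def)
        moreover have "u \<le> s i" if "i \<in> J" for i
          using that finJ by (simp add: u_def)
        ultimately have "J = {i\<in>I. u \<le> s i}" by (force simp: J_def)
        then show ?thesis using J less.prems(3)[of u] by simp
      qed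
    qed
    have "(L - m) * c \<le> (\<Sum>i\<in>J. (s i - m) * d i)"
    proof (rule less.hyps[OF card finJ less.prems(2) lev])
      show "0 \<le> s i - m \<and> s i - m \<le> L - m" if "i \<in> J" for i
        using that less.prems(4)[of i] by (auto simp: J_def)
      show "0 \<le> L - m" using z less.prems(4) by force
    qed
    also have "\<dots> = (\<Sum>i\<in>I. (s i - m) * d i)"
      using less.prems(1) m_le by (intro sum.mono_neutral_left) (force simp: J_def)+
    also have "\<dots> = (\<Sum>i\<in>I. s i * d i) - m * sum d I"
      by (simp add: algebra_simps sum_subtractf sum_distrib_left)
    finally have "(L - m) * c \<le> (\<Sum>i\<in>I. s i * d i) - m * sum d I" .
    moreover have "{i\<in>I. m \<le> s i} = I" using m_le by auto
    then have "c \<le> sum d I" using less.prems(3)[of m] by simp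
    then have "m * c \<le> m * sum d I"
      using z less.prems(4) by (intro mult_left_mono) auto
    ultimately show ?thesis by (simp add: algebra_simps)
  qed
qed

section \<open>Entropy of traces and of differences\<close>

definition tent :: "'a set set \<Rightarrow> 'a set \<Rightarrow> real" where
  "tent \<A> S = uent \<A> (\<lambda>A. A \<inter> S)"

definition freq :: "'a set set \<Rightarrow> 'a \<Rightarrow> real" where
  "freq \<A> i = card {A\<in>\<A>. i \<in> A} / card \<A>"

lemma freq_in_unit:
  assumes "finite \<A>"
  shows "freq \<A> i \<in> {0..1}"
proof -
  have "card {A\<in>\<A>. i \<in> A} \<le> card \<A>" using assms by (intro card_mono) auto
  then show ?thesis by (cases "card \<A> = 0") (simp_all add: freq_def)
qed

lemma tent_empty: "tent \<A> {} = 0"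
  by (simp add: tent_def uent_const)

lemma tent_singleton:
  assumes "finite \<A>" "\<A> \<noteq> {}"
  shows "tent \<A> {i} = bent (freq \<A> i)"
proof -
  have "tent \<A> {i} = uent \<A> (\<lambda>A. i \<in> A)"
    unfolding tent_def by (rule uent_cong) auto
  then show ?thesis using uent_pred[OF assms] by (simp add: freq_def)
qed

lemma tent_Union:
  assumes "\<A> \<subseteq> Pow I"
  shows "tent \<A> I = log 2 (card \<A>)"
  unfolding tent_def using assms by (intro uent_inj_on inj_onI) blast

text \<open>For \<open>S \<subseteq> T\<close> the trace on \<open>T\<close> determines the trace on
  \<open>S\<close>, so this is submodularity for membership of \<open>i\<close> and the trace on
  \<open>T\<close>, given the trace on \<open>S\<close>.\<close>

lemma tent_submodular:
  assumes "finite \<A>" and "S \<subseteq> T"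
  shows "tent \<A> (insert i T) + tent \<A> S \<le> tent \<A> (insert i S) + tent \<A> T"
proof -
  have "tent \<A> (insert i T) = uent \<A> (\<lambda>A. (i \<in> A, A \<inter> T, A \<inter> S))"
    "tent \<A> (insert i S) = uent \<A> (\<lambda>A. (i \<in> A, A \<inter> S))"
    "tent \<A> T = uent \<A> (\<lambda>A. (A \<inter> T, A \<inter> S))"
    unfolding tent_def using assms(2) by (auto intro!: uent_cong)
  then show ?thesis
    using uent_submodular[OF assms(1), of "\<lambda>A. i \<in> A" "\<lambda>A. A \<inter> T" "\<lambda>A. A \<inter> S"]
    by (simp add: tent_def)
qed

section \<open>Entropies on the product of the two families\<close>

lemma uent_fst:
  assumes "finite \<A>" "finite \<B>" "\<B> \<noteq> {}"
  shows "uent (\<A> \<times> \<B>) (\<lambda>w. f (fst w)) = uent \<A> f"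
proof (cases "\<A> = {}")
  case False
  have fib: "{v\<in>\<A> \<times> \<B>. f (fst v) = f a} = {a'\<in>\<A>. f a' = f a} \<times> \<B>" for a
    by auto
  define n where "n = real (card \<B>)"
  have n: "n > 0" using assms by (simp add: n_def card_gt_0_iff)
  have m: "real (card \<A>) > 0" using assms False by (simp add: card_gt_0_iff)
  have pos: "real (card {a'\<in>\<A>. f a' = f a}) > 0" if "a \<in> \<A>" for a
    using that assms(1) by (auto simp: card_gt_0_iff)
  have "(\<Sum>w\<in>\<A> \<times> \<B>. log 2 (card {v\<in>\<A> \<times> \<B>. f (fst v) = f (fst w)}))
      = (\<Sum>a\<in>\<A>. \<Sum>b\<in>\<B>. log 2 (card {a'\<in>\<A>. f a' = f a} * n))"
    unfolding sum.cartesian_product by (simp add: fib card_cartesian_product case_prod_beta n_def)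
  also have "\<dots> = (\<Sum>a\<in>\<A>. n * (log 2 (card {a'\<in>\<A>. f a' = f a}) + log 2 n))"
    using pos n by (intro sum.cong) (auto simp: log_mult n_def)
  also have "\<dots> = n * ((\<Sum>a\<in>\<A>. log 2 (card {a'\<in>\<A>. f a' = f a})) + card \<A> * log 2 n)"
    by (simp add: sum_distrib_left[symmetric] sum.distrib)
  finally show ?thesis
    using n m by (simp add: uent_def card_cartesian_product n_def[symmetric] log_mult field_simps)
qed (simp add: uent_def)

text \<open>The chain rule: by \<open>rec\<close>, the fibre of \<open>A - B\<close> is
  \<open>{A}\<close> times the set of all \<open>B'\<close> with the same trace on
  \<open>A\<close>.\<close>

lemma uent_diff_eq:
  assumes fin: "finite \<A>" "finite \<B>" and ne: "\<A> \<noteq> {}" "\<B> \<noteq> {}"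
    and rec: "\<forall>A\<in>\<A>. \<forall>A'\<in>\<A>. \<forall>B\<in>\<B>. \<forall>B'\<in>\<B>. A - B = A' - B' \<longrightarrow> A = A'"
  shows "uent (\<A> \<times> \<B>) (\<lambda>w. fst w - snd w) = log 2 (card \<A>) + (\<Sum>A\<in>\<A>. tent \<B> A) / card \<A>"
proof -
  define m n where "m = real (card \<A>)" and "n = real (card \<B>)"
  have mn: "m > 0" "n > 0" using fin ne by (simp_all add: m_def n_def card_gt_0_iff)
  have fib: "card {v\<in>\<A> \<times> \<B>. fst v - snd v = A - B} = card {B'\<in>\<B>. B' \<inter> A = B \<inter> A}"
    if "A \<in> \<A>" "B \<in> \<B>" for A B
  proof -
    have "{v\<in>\<A> \<times> \<B>. fst v - snd v = A - B} = {A} \<times> {B'\<in>\<B>. B' \<inter> A = B \<inter> A}" (is "?L = ?R")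
    proof (intro equalityI subsetI)
      fix v assume "v \<in> ?L"
      then have v: "fst v \<in> \<A>" "snd v \<in> \<B>" "fst v - snd v = A - B" by auto
      then have "fst v = A" using rec that by blast
      then show "v \<in> ?R" using v by (auto simp: mem_Times_iff)
    next
      fix v assume "v \<in> ?R"
      then obtain B' where "v = (A, B')" "B' \<in> \<B>" "B' \<inter> A = B \<inter> A" by auto
      moreover from this have "A - B' = A - B" by blast
      ultimately show "v \<in> ?L" using that by simp
    qed
    then show ?thesis by (simp add: card_cartesian_product)
  qed
  have "(\<Sum>w\<in>\<A> \<times> \<B>. log 2 (card {v\<in>\<A> \<times> \<B>. fst v - snd v = fst w - snd w}))
      = (\<Sum>A\<in>\<A>. \<Sum>B\<in>\<B>. log 2 (card {B'\<in>\<B>. B' \<inter> A = B \<inter> A}))"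
    unfolding sum.cartesian_product by (intro sum.cong) (auto simp: fib)
  also have "\<dots> = (\<Sum>A\<in>\<A>. n * (log 2 n - tent \<B> A))"
    using mn(2) by (simp add: tent_def uent_def n_def)
  also have "\<dots> = n * (m * log 2 n - (\<Sum>A\<in>\<A>. tent \<B> A))"
    by (simp add: sum_distrib_left[symmetric] sum_subtractf m_def)
  finally have "uent (\<A> \<times> \<B>) (\<lambda>w. fst w - snd w)
      = log 2 (m * n) - n * (m * log 2 n - (\<Sum>A\<in>\<A>. tent \<B> A)) / (m * n)"
    by (simp add: uent_def card_cartesian_product m_def n_def)
  also have "\<dots> = log 2 m + (\<Sum>A\<in>\<A>. tent \<B> A) / m"
    using mn by (simp add: log_mult diff_divide_distrib right_diff_distrib)
  finally show ?thesis by (simp add: m_def)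
qed

lemma uent_diff_mem:
  assumes fin: "finite \<A>" "finite \<B>" and ne: "\<A> \<noteq> {}" "\<B> \<noteq> {}"
  shows "uent (\<A> \<times> \<B>) (\<lambda>w. i \<in> fst w - snd w) = bent (freq \<A> i * (1 - freq \<B> i))"
proof -
  have "{B\<in>\<B>. i \<notin> B} = \<B> - {B\<in>\<B>. i \<in> B}" by blast
  then have "real (card {B\<in>\<B>. i \<notin> B}) = real (card \<B>) - card {B\<in>\<B>. i \<in> B}"
    using fin(2) by (simp add: card_Diff_subset card_mono of_nat_diff)
  then have "real (card {B\<in>\<B>. i \<notin> B}) = (1 - freq \<B> i) * card \<B>"
    using fin ne by (simp add: freq_def left_diff_distrib)
  moreover have "{w\<in>\<A> \<times> \<B>. i \<in> fst w - snd w} = {A\<in>\<A>. i \<in> A} \<times> {B\<in>\<B>. i \<notin> B}"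
    by auto
  ultimately have "real (card {w\<in>\<A> \<times> \<B>. i \<in> fst w - snd w}) / card (\<A> \<times> \<B>)
      = card {A\<in>\<A>. i \<in> A} * ((1 - freq \<B> i) * card \<B>) / (card \<A> * card \<B>)"
    by (simp only: card_cartesian_product of_nat_mult)
  also have "\<dots> = freq \<A> i * (1 - freq \<B> i)"
    using fin ne by (simp add: freq_def)
  finally have "real (card {w\<in>\<A> \<times> \<B>. i \<in> fst w - snd w}) / card (\<A> \<times> \<B>)
      = freq \<A> i * (1 - freq \<B> i)" .
  then show ?thesis
    using fin ne by (subst uent_pred) auto
qed

text \<open>Once it is known whether \<open>i \<in> A\<close>, nothing is uncertain if
  \<open>i \<notin> A\<close>; otherwise the question is whether \<open>i \<in> B\<close>, which is
  independent of \<open>A\<close>.\<close>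

lemma uent_diff_mem_cond:
  assumes fin: "finite \<A>" "finite \<B>" and ne: "\<A> \<noteq> {}" "\<B> \<noteq> {}"
  shows "uent (\<A> \<times> \<B>) (\<lambda>w. (i \<in> fst w - snd w, i \<in> fst w)) - uent (\<A> \<times> \<B>) (\<lambda>w. i \<in> fst w)
       = freq \<A> i * bent (freq \<B> i)"
proof -
  define m n where "m = real (card \<A>)" and "n = real (card \<B>)"
  have mn: "m > 0" "n > 0" using fin ne by (simp_all add: m_def n_def card_gt_0_iff)
  define a where "a = real (card {A\<in>\<A>. i \<in> A})"
  \<comment> \<open>Logarithms of the fibre sizes before and after revealing whether
    \<open>i \<in> A - B\<close>; the average of their difference is the conditional
    entropy.\<close>
  let ?f1 = "\<lambda>w. log 2 (card {v\<in>\<A> \<times> \<B>. (i \<in> fst v) = (i \<in> fst w)})"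
  let ?f2 = "\<lambda>w. log 2 (card {v\<in>\<A> \<times> \<B>. (i \<in> fst v - snd v, i \<in> fst v) = (i \<in> fst w - snd w, i \<in> fst w)})"
  have "(\<Sum>w\<in>\<A> \<times> \<B>. ?f1 w - ?f2 w) = (\<Sum>A\<in>\<A>. \<Sum>B\<in>\<B>. ?f1 (A, B) - ?f2 (A, B))"
    by (simp add: sum.cartesian_product case_prod_beta)
  also have "\<dots> = (\<Sum>A\<in>\<A>. if i \<in> A then n * bent (freq \<B> i) else 0)"
  proof (rule sum.cong[OF refl])
    fix A assume A: "A \<in> \<A>"
    show "(\<Sum>B\<in>\<B>. ?f1 (A, B) - ?f2 (A, B)) = (if i \<in> A then n * bent (freq \<B> i) else 0)"
    proof (cases "i \<in> A")
      case True
      have a: "a > 0" using True A fin(1) by (auto simp: a_def card_gt_0_iff)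
      have "?f1 (A, B) - ?f2 (A, B) = log 2 n - log 2 (card {B'\<in>\<B>. (i \<in> B') = (i \<in> B)})"
        if "B \<in> \<B>" for B
      proof -
        have "{v\<in>\<A> \<times> \<B>. (i \<in> fst v) = (i \<in> A)} = {A\<in>\<A>. i \<in> A} \<times> \<B>"
          using True by auto
        moreover have "{v\<in>\<A> \<times> \<B>. (i \<in> fst v - snd v, i \<in> fst v) = (i \<in> A - B, i \<in> A)}
            = {A\<in>\<A>. i \<in> A} \<times> {B'\<in>\<B>. (i \<in> B') = (i \<in> B)}"
          using True by auto
        moreover have "real (card {B'\<in>\<B>. (i \<in> B') = (i \<in> B)}) > 0"
          using that fin(2) by (auto simp: card_gt_0_iff)
        ultimately show ?thesis
          using a mn by (simp add: card_cartesian_product log_mult a_def[symmetric] n_def[symmetric])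
      qed
      then have "(\<Sum>B\<in>\<B>. ?f1 (A, B) - ?f2 (A, B))
          = n * log 2 n - (\<Sum>B\<in>\<B>. log 2 (card {B'\<in>\<B>. (i \<in> B') = (i \<in> B)}))"
        by (simp add: sum_subtractf n_def)
      also have "\<dots> = n * uent \<B> (\<lambda>B. i \<in> B)"
        using mn by (simp add: uent_def n_def[symmetric] field_simps)
      finally show ?thesis
        using True uent_pred[OF fin(2) ne(2)] by (simp add: freq_def)
    next
      case False
      have "?f1 (A, B) = ?f2 (A, B)" for B
        using False by (intro arg_cong[where f = "\<lambda>S. log 2 (real (card S))"]) auto
      then show ?thesis using False by simp
    qed
  qed
  also have "\<dots> = a * n * bent (freq \<B> i)"
    using fin(1) by (simp add: sum.If_cases a_def Int_def)
  finally have sum_diff: "(\<Sum>w\<in>\<A> \<times> \<B>. ?f1 w - ?f2 w) = a * n * bent (freq \<B> i)" .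
  have "uent (\<A> \<times> \<B>) (\<lambda>w. (i \<in> fst w - snd w, i \<in> fst w)) - uent (\<A> \<times> \<B>) (\<lambda>w. i \<in> fst w)
      = (\<Sum>w\<in>\<A> \<times> \<B>. ?f1 w - ?f2 w) / (m * n)"
    by (simp only: uent_def sum_subtractf diff_divide_distrib card_cartesian_product of_nat_mult m_def n_def)
  also have "\<dots> = freq \<A> i * bent (freq \<B> i)"
    using mn unfolding sum_diff by (simp add: freq_def a_def m_def)
  finally show ?thesis .
qed

text \<open>Reveal the trace on \<open>D\<close> first and then membership in the difference, one
  index at a time; \<open>step\<close> bounds the cost of each index.\<close>

lemma uent_diff_le:
  assumes fin: "finite \<A>" "finite \<B>" and ne: "\<A> \<noteq> {}" "\<B> \<noteq> {}"
    and I: "finite I" "\<A> \<subseteq> Pow I" and D: "D \<subseteq> I"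
    and rec: "\<forall>A\<in>\<A>. \<forall>A'\<in>\<A>. \<forall>B\<in>\<B>. \<forall>B'\<in>\<B>. A - B = A' - B' \<longrightarrow> A = A'"
  shows "uent (\<A> \<times> \<B>) (\<lambda>w. fst w - snd w) \<le> tent \<A> D +
    (\<Sum>i\<in>I. if i \<in> D then freq \<A> i * bent (freq \<B> i) else bent (freq \<A> i * (1 - freq \<B> i)))"
proof -
  let ?\<Omega> = "\<A> \<times> \<B>"
  let ?c = "\<lambda>i. if i \<in> D then freq \<A> i * bent (freq \<B> i) else bent (freq \<A> i * (1 - freq \<B> i))"
  let ?g = "\<lambda>J w. (fst w \<inter> D, (fst w - snd w) \<inter> J)"
  have fin\<Omega>: "finite ?\<Omega>" using fin by simp
  have step: "uent ?\<Omega> (?g (insert i J)) \<le> uent ?\<Omega> (?g J) + ?c i" for i J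
  proof (cases "i \<in> D")
    case True
    \<comment> \<open>As \<open>i \<in> D\<close>, the trace in \<open>?g J\<close> already tells
      whether \<open>i \<in> fst w\<close>, so conditioning on it is free.\<close>
    have "uent ?\<Omega> (\<lambda>w. (i \<in> fst w - snd w, ?g J w, i \<in> fst w)) = uent ?\<Omega> (?g (insert i J))"
      "uent ?\<Omega> (\<lambda>w. (?g J w, i \<in> fst w)) = uent ?\<Omega> (?g J)"
      using True by (intro uent_cong; simp only: prod.inject set_eq_iff Int_iff Diff_iff insert_iff; blast)+
    then show ?thesis
      using uent_submodular[OF fin\<Omega>, of "\<lambda>w. i \<in> fst w - snd w" "?g J" "\<lambda>w. i \<in> fst w"]
        uent_diff_mem_cond[OF fin ne, of i] True by simp
  next
    case False
    \<comment> \<open>Conditioning on the constant \<open>()\<close> turns submodularity into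
      subadditivity.\<close>
    have "uent ?\<Omega> (\<lambda>w. (i \<in> fst w - snd w, ?g J w, ())) = uent ?\<Omega> (?g (insert i J))"
      "uent ?\<Omega> (\<lambda>w. (?g J w, ())) = uent ?\<Omega> (?g J)"
      "uent ?\<Omega> (\<lambda>w. (i \<in> fst w - snd w, ())) = uent ?\<Omega> (\<lambda>w. i \<in> fst w - snd w)"
      by (auto intro!: uent_cong)
    then show ?thesis
      using uent_submodular[OF fin\<Omega>, of "\<lambda>w. i \<in> fst w - snd w" "?g J" "\<lambda>w. ()"]
        uent_diff_mem[OF fin ne, of i] uent_const[of ?\<Omega> "()"] False by simp
  qed
  have "uent ?\<Omega> (?g I) \<le> tent \<A> D + (\<Sum>i\<in>I. ?c i)"
    using I(1)
  proof (induction I)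
    case empty
    have "uent ?\<Omega> (?g {}) = uent ?\<Omega> (\<lambda>w. fst w \<inter> D)"
      by (rule uent_cong) auto
    then show ?case
      using uent_fst[OF fin ne(2), of "\<lambda>A. A \<inter> D"] by (simp add: tent_def)
  next
    case (insert i J)
    then show ?case using step[of i J] by simp
  qed
  \<comment> \<open>By \<open>rec\<close> the difference determines \<open>A\<close>, hence also the
    trace on \<open>D\<close> that was revealed first.\<close>
  moreover have "uent ?\<Omega> (?g I) = uent ?\<Omega> (\<lambda>w. fst w - snd w)"
  proof (rule uent_cong)
    fix v w assume v: "v \<in> ?\<Omega>" and w: "w \<in> ?\<Omega>"
    have "(fst v - snd v) \<inter> I = fst v - snd v" "(fst w - snd w) \<inter> I = fst w - snd w"
      using v w I(2) by (auto simp: subset_iff)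
    moreover have "fst v = fst w" if "fst v - snd v = fst w - snd w"
      using rec v w that by (metis mem_Times_iff)
    ultimately show "?g I v = ?g I w \<longleftrightarrow> fst v - snd v = fst w - snd w" by auto
  qed
  ultimately show ?thesis by simp
qed

text \<open>The lower bound on the entropy of \<open>A - B\<close> through \<open>y\<close> is
  compared with the upper bound for each level set \<open>D\<close> of \<open>s\<close>, and the
  comparisons are averaged with total weight \<open>L\<close>. On these sets \<open>x\<close>
  replaces the trace entropy.\<close>

lemma weighted_side_bound:
  assumes fin: "finite \<A>" "finite \<B>" and ne: "\<A> \<noteq> {}" "\<B> \<noteq> {}"
    and I: "finite I" "\<A> \<subseteq> Pow I"
    and rec: "\<forall>A\<in>\<A>. \<forall>A'\<in>\<A>. \<forall>B\<in>\<B>. \<forall>B'\<in>\<B>. A - B = A' - B' \<longrightarrow> A = A'"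
    and x: "\<And>t. sum x {i\<in>I. t \<le> s i} = tent \<A> {i\<in>I. t \<le> s i}"
    and y: "\<And>S. S \<subseteq> I \<Longrightarrow> sum y S \<le> tent \<B> S"
    and s: "\<And>i. i \<in> I \<Longrightarrow> 0 \<le> s i \<and> s i \<le> L" and L: "0 \<le> L"
  shows "L * (log 2 (card \<A>) + (\<Sum>i\<in>I. freq \<A> i * y i)) \<le>
    (\<Sum>i\<in>I. (L - s i) * bent (freq \<A> i * (1 - freq \<B> i)) + s i * (x i + freq \<A> i * bent (freq \<B> i)))"
proof -
  define u where "u = (\<lambda>i. freq \<A> i * bent (freq \<B> i))"
  define v where "v = (\<lambda>i. bent (freq \<A> i * (1 - freq \<B> i)))"
  \<comment> \<open>The lower bound minus the cost of revealing no trace at all; taking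
    \<open>D = {}\<close> gives \<open>c \<le> 0\<close>, as the averaging requires.\<close>
  define c where "c = log 2 (card \<A>) + (\<Sum>i\<in>I. freq \<A> i * y i) - sum v I"
  \<comment> \<open>Double counting: the left-hand side is the mean of \<open>sum y A\<close> over
    \<open>A\<close>.\<close>
  have "(\<Sum>i\<in>I. freq \<A> i * y i) = (\<Sum>i\<in>I. \<Sum>A\<in>\<A>. if i \<in> A then y i else 0) / card \<A>"
    using fin(1) by (simp add: sum.If_cases Int_def freq_def sum_divide_distrib)
  also have "\<dots> = (\<Sum>A\<in>\<A>. \<Sum>i\<in>I. if i \<in> A then y i else 0) / card \<A>"
    by (subst sum.swap) simp
  also have "\<dots> = (\<Sum>A\<in>\<A>. sum y A) / card \<A>"
  proof -
    have "(\<Sum>i\<in>I. if i \<in> A then y i else 0) = sum y A" if "A \<in> \<A>" for A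
      using that I by (auto simp: sum.If_cases Int_absorb1)
    then show ?thesis by simp
  qed
  also have "\<dots> \<le> (\<Sum>A\<in>\<A>. tent \<B> A) / card \<A>"
    using I(2) y by (intro divide_right_mono sum_mono) auto
  finally have H: "log 2 (card \<A>) + (\<Sum>i\<in>I. freq \<A> i * y i)
      \<le> uent (\<A> \<times> \<B>) (\<lambda>w. fst w - snd w)"
    using uent_diff_eq[OF fin ne rec] by simp
  have split: "(\<Sum>i\<in>I. if i \<in> D then u i else v i) = sum v I + (\<Sum>i\<in>D. u i - v i)" if "D \<subseteq> I" for D
  proof -
    have "(\<Sum>i\<in>I. if i \<in> D then u i else v i) = sum v I + (\<Sum>i\<in>I. if i \<in> D then u i - v i else 0)"
      by (subst sum.distrib[symmetric]) (auto intro: sum.cong)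
    also have "(\<Sum>i\<in>I. if i \<in> D then u i - v i else 0) = (\<Sum>i\<in>D. u i - v i)"
      using that I(1) by (simp add: sum.If_cases Int_absorb1)
    finally show ?thesis .
  qed
  have le: "c \<le> tent \<A> D + (\<Sum>i\<in>D. u i - v i)" if "D \<subseteq> I" for D
  proof -
    have "uent (\<A> \<times> \<B>) (\<lambda>w. fst w - snd w) \<le> tent \<A> D + (\<Sum>i\<in>I. if i \<in> D then u i else v i)"
      unfolding u_def v_def by (rule uent_diff_le[OF fin ne I that rec])
    then show ?thesis using H split[OF that] by (simp add: c_def)
  qed
  have "c \<le> 0" using le[of "{}"] by (simp add: tent_empty)
  then have "L * c \<le> (\<Sum>i\<in>I. s i * (x i + (u i - v i)))"
  proof (rule layered_sum_ge[OF I(1) _ _ s L])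
    fix t
    show "c \<le> (\<Sum>i\<in>{i\<in>I. t \<le> s i}. x i + (u i - v i))"
      using le[of "{i\<in>I. t \<le> s i}"] x[of t] by (simp add: sum.distrib)
  qed
  then have "L * (log 2 (card \<A>) + (\<Sum>i\<in>I. freq \<A> i * y i))
      \<le> (\<Sum>i\<in>I. L * v i + s i * (x i + (u i - v i)))"
    by (simp add: c_def sum.distrib sum_distrib_left right_diff_distrib distrib_left)
  also have "\<dots> = (\<Sum>i\<in>I. (L - s i) * v i + s i * (x i + u i))"
    by (simp add: algebra_simps)
  finally show ?thesis by (simp add: u_def v_def)
qed

section \<open>The per-coordinate inequality\<close>

text \<open>The share of one coordinate in one side's bound: \<open>max 0 (10 * q - 3)\<close> out
  of 10 is the weight of the layers containing it, and the last summand bounds the remaining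
  multiple of \<open>x\<^sub>i\<close> through \<open>x\<^sub>i \<le> bent p\<close>.\<close>

definition wcost :: "real \<Rightarrow> real \<Rightarrow> real" where
  "wcost p q = (10 - max 0 (10 * q - 3)) * bent (p * (1 - q)) + max 0 (10 * q - 3) * (p * bent q)
     + max 0 (3 - 10 * q) * bent p"

definition chord :: "real \<Rightarrow> real \<Rightarrow> real \<Rightarrow> real" where
  "chord U W x = (1 - x) * U + x * W"

text \<open>With \<open>U = - log 2 (1 - r)\<close> and \<open>W = - log 2 r\<close> this is the tangent of \<open>bent\<close> at \<open>r\<close>; \<open>U \<le> W\<close> says
  \<open>r \<le> 1/2\<close>, which keeps the resulting bounds convex in each variable.\<close>

definition bent_line :: "real \<Rightarrow> real \<Rightarrow> bool" where
  "bent_line U W \<longleftrightarrow> U \<le> W \<and> (\<forall>x\<in>{0..1}. bent x \<le> chord U W x)"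

section \<open>Rational tangent bounds for the binary entropy\<close>

lemma bent_cross_entropy:
  assumes "0 \<le> x" "x \<le> 1" "0 < r" "r < 1"
  shows "bent x \<le> - x * log 2 r - (1 - x) * log 2 (1 - r)"
proof -
  \<comment> \<open>Gibbs' inequality for one outcome; over the two outcomes the linear terms
    cancel.\<close>
  have "y * (log 2 t - log 2 y) \<le> (t - y) / ln 2" if "0 \<le> y" "0 < t" for y t :: real
  proof (cases "y = 0")
    case False
    then have y: "y > 0" using that by simp
    have "ln (t / y) \<le> t / y - 1" using that y by (intro ln_le_minus_one) auto
    then have "y * ln (t / y) \<le> y * (t / y - 1)" using y by (intro mult_left_mono) auto
    also have "\<dots> = t - y" using y by (simp add: right_diff_distrib)
    finally have "y * ln (t / y) / ln 2 \<le> (t - y) / ln 2" by (intro divide_right_mono) auto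
    then show ?thesis using that y by (simp add: log_def ln_div diff_divide_distrib right_diff_distrib)
  qed (use that in simp)
  from this[of x r] this[of "1 - x" "1 - r"] assms
  have "x * (log 2 r - log 2 x) + (1 - x) * (log 2 (1 - r) - log 2 (1 - x))
      \<le> (r - x) / ln 2 + ((1 - r) - (1 - x)) / ln 2"
    by fastforce
  also have "\<dots> = 0" by (simp add: add_divide_distrib[symmetric])
  finally show ?thesis by (simp add: bent_def algebra_simps)
qed

text \<open>Reduces a rational bound on a logarithm to a numerical comparison of powers.\<close>

lemma log2_le:
  fixes a :: real
  assumes "0 < a" "0 < m" "a ^ m \<le> 2 ^ k"
  shows "log 2 a \<le> k / m"
proof -
  have "log 2 (a ^ m) \<le> log 2 (2 ^ k)"
    using assms by (subst log_le_cancel_iff) auto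
  then show ?thesis
    using assms by (simp add: log_nat_power field_simps)
qed

lemma log2_ge:
  fixes a :: real
  assumes "0 < a" "0 < m" "2 ^ k \<le> a ^ m"
  shows "k / m \<le> log 2 a"
proof -
  have "log 2 (2 ^ k) \<le> log 2 (a ^ m)"
    using assms by (subst log_le_cancel_iff) auto
  then show ?thesis
    using assms by (simp add: log_nat_power field_simps)
qed

lemma bent_lineI:
  fixes r :: real
  assumes "0 < r" "r < 1" "U \<le> W" "- log 2 (1 - r) \<le> U" "- log 2 r \<le> W"
  shows "bent_line U W"
  unfolding bent_line_def
proof (intro conjI ballI)
  fix x :: real assume x: "x \<in> {0..1}"
  have "x * - log 2 r \<le> x * W" "(1 - x) * - log 2 (1 - r) \<le> (1 - x) * U"
    using x assms by (intro mult_left_mono; simp)+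
  then show "bent x \<le> chord U W x"
    using bent_cross_entropy[of x r] x assms by (simp add: chord_def)
qed (use assms in simp)

text \<open>Tangents at 1/10, 3/20, 1/5, 1/4, 3/10, 2/5 and 1/2, rounded up to three decimals. The fractions
  bounding the logarithms of primes come from their continued fractions.\<close>

lemma bent_lines:
  "bent_line (153/1000) (3322/1000)"
  "bent_line (235/1000) (2737/1000)"
  "bent_line (322/1000) (2322/1000)"
  "bent_line (416/1000) 2"
  "bent_line (515/1000) (1737/1000)"
  "bent_line (737/1000) (1322/1000)"
  "bent_line 1 1"
proof -
  have L: "569 / 359 \<le> log 2 3" "log 2 5 \<le> 476 / 205" "233 / 83 \<le> log 2 7" "421 / 103 \<le> log 2 17"
    using log2_ge[of 3 359 569] log2_le[of 5 205 476] log2_ge[of 7 83 233] log2_ge[of 17 103 421] by simp_all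
  have "log 2 4 = log 2 (2 * 2)" "log 2 9 = log 2 (3 * 3)" "log 2 10 = log 2 (2 * 5)" "log 2 20 = log 2 (2 * (2 * 5))"
    by simp_all
  then have E: "log 2 4 = 2" "log 2 9 = 2 * log 2 3" "log 2 10 = 1 + log 2 5" "log 2 20 = 2 + log 2 5"
    by (simp_all only: log_mult) simp_all
  note simps = log_divide E
  show "bent_line (153/1000) (3322/1000)"
    by (rule bent_lineI[of "1/10"]) (use L in \<open>simp_all add: simps\<close>)
  show "bent_line (235/1000) (2737/1000)"
    by (rule bent_lineI[of "3/20"]) (use L in \<open>simp_all add: simps\<close>)
  show "bent_line (322/1000) (2322/1000)"
    by (rule bent_lineI[of "1/5"]) (use L in \<open>simp_all add: simps\<close>)
  show "bent_line (416/1000) 2"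
    by (rule bent_lineI[of "1/4"]) (use L in \<open>simp_all add: simps\<close>)
  show "bent_line (515/1000) (1737/1000)"
    by (rule bent_lineI[of "3/10"]) (use L in \<open>simp_all add: simps\<close>)
  show "bent_line (737/1000) (1322/1000)"
    by (rule bent_lineI[of "2/5"]) (use L in \<open>simp_all add: simps\<close>)
  show "bent_line 1 1"
    by (rule bent_lineI[of "1/2"]) (use L in \<open>simp_all add: simps\<close>)
qed

definition low_bound :: "real \<times> real \<Rightarrow> real \<times> real \<Rightarrow> real \<Rightarrow> real \<Rightarrow> real" where
  "low_bound = (\<lambda>(U1, W1) (U2, W2) p q. 10 * chord U1 W1 (p * (1 - q)) + (3 - 10 * q) * chord U2 W2 p)"

text \<open>For \<open>q \<ge> 3/10\<close> the weight \<open>10 - (10 * q - 3)\<close> is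
  \<open>13 - 10 * q\<close>, and the term with \<open>bent p\<close> vanishes.\<close>

definition high_bound :: "real \<times> real \<Rightarrow> real \<times> real \<Rightarrow> real \<Rightarrow> real \<Rightarrow> real" where
  "high_bound = (\<lambda>(U1, W1) (U2, W2) p q. (13 - 10 * q) * chord U1 W1 (p * (1 - q)) + (10 * q - 3) * (p * chord U2 W2 q))"

lemma wcost_low:
  assumes "p \<in> {0..1}" "q \<in> {0..1}" "q \<le> 3/10" "case_prod bent_line L1" "case_prod bent_line L2"
  shows "wcost p q \<le> low_bound L1 L2 p q"
proof -
  obtain U1 W1 U2 W2 where L: "L1 = (U1, W1)" "L2 = (U2, W2)" by fastforce
  have "p * (1 - q) \<in> {0..1}" using assms(1,2) by (auto intro: mult_le_one)
  then have "bent (p * (1 - q)) \<le> chord U1 W1 (p * (1 - q))" "bent p \<le> chord U2 W2 p"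
    using assms by (auto simp: bent_line_def L)
  then have "10 * bent (p * (1 - q)) \<le> 10 * chord U1 W1 (p * (1 - q))"
    "(3 - 10 * q) * bent p \<le> (3 - 10 * q) * chord U2 W2 p"
    using assms(3) by (auto intro: mult_left_mono)
  moreover have "max 0 (10 * q - 3) = 0" "max 0 (3 - 10 * q) = 3 - 10 * q" using assms(3) by auto
  ultimately show ?thesis by (simp add: wcost_def low_bound_def L)
qed

lemma wcost_high:
  assumes "p \<in> {0..1}" "q \<in> {0..1}" "3/10 \<le> q" "case_prod bent_line L1" "case_prod bent_line L2"
  shows "wcost p q \<le> high_bound L1 L2 p q"
proof -
  obtain U1 W1 U2 W2 where L: "L1 = (U1, W1)" "L2 = (U2, W2)" by fastforce
  have "p * (1 - q) \<in> {0..1}" using assms(1,2) by (auto intro: mult_le_one)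
  then have "bent (p * (1 - q)) \<le> chord U1 W1 (p * (1 - q))" "bent q \<le> chord U2 W2 q"
    using assms by (auto simp: bent_line_def L)
  then have "(13 - 10 * q) * bent (p * (1 - q)) \<le> (13 - 10 * q) * chord U1 W1 (p * (1 - q))"
    "(10 * q - 3) * (p * bent q) \<le> (10 * q - 3) * (p * chord U2 W2 q)"
    using assms(1,2,3) by (auto intro!: mult_left_mono)
  moreover have "max 0 (10 * q - 3) = 10 * q - 3" "max 0 (3 - 10 * q) = 0" using assms(3) by auto
  ultimately show ?thesis by (simp add: wcost_def high_bound_def L)
qed

section \<open>Reduction from rectangles to their corners\<close>

definition convex_quadratic :: "(real \<Rightarrow> real) \<Rightarrow> bool" where
  "convex_quadratic f \<longleftrightarrow> (\<exists>\<alpha> \<beta> \<gamma>. 0 \<le> \<alpha> \<and> (\<forall>x. f x = \<alpha> * x\<^sup>2 + \<beta> * x + \<gamma>))"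

lemma convex_quadraticI:
  assumes "\<And>x. f x = \<alpha> * x\<^sup>2 + \<beta> * x + \<gamma>" "0 \<le> \<alpha>"
  shows "convex_quadratic f"
  using assms unfolding convex_quadratic_def by blast

lemma convex_quadratic_add:
  assumes "convex_quadratic f" "convex_quadratic g"
  shows "convex_quadratic (\<lambda>x. f x + g x)"
proof -
  from assms obtain \<alpha> \<beta> \<gamma> \<alpha>' \<beta>' \<gamma>' where "\<alpha> \<ge> 0" "\<alpha>' \<ge> 0"
    "\<And>x. f x = \<alpha> * x\<^sup>2 + \<beta> * x + \<gamma>" "\<And>x. g x = \<alpha>' * x\<^sup>2 + \<beta>' * x + \<gamma>'"
    unfolding convex_quadratic_def by blast
  then show ?thesis
    by (intro convex_quadraticI[of _ "\<alpha> + \<alpha>'" "\<beta> + \<beta>'" "\<gamma> + \<gamma>'"]) (auto simp: algebra_simps)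
qed

lemma convex_quadratic_le:
  assumes f: "convex_quadratic f" and x: "x \<in> {a..b}" and ends: "f a \<le> m" "f b \<le> m"
  shows "f x \<le> m"
proof (cases "a = b")
  case False
  then have ab: "b - a > 0" using x by simp
  obtain \<alpha> \<beta> \<gamma> where \<alpha>: "\<alpha> \<ge> 0" and f_eq: "\<And>x. f x = \<alpha> * x\<^sup>2 + \<beta> * x + \<gamma>"
    using f unfolding convex_quadratic_def by blast
  \<comment> \<open>A quadratic lies below its chord by exactly
    \<open>\<alpha> * ((x - a) * (b - x))\<close>.\<close>
  have "(b - a) * f x = (b - x) * f a + (x - a) * f b - (b - a) * (\<alpha> * ((x - a) * (b - x)))"
    by (simp add: f_eq power2_eq_square algebra_simps)
  also have "\<dots> \<le> (b - x) * m + (x - a) * m - 0"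
    using x ends \<alpha> by (intro diff_mono add_mono mult_left_mono) auto
  also have "\<dots> = (b - a) * m" by (simp add: algebra_simps)
  finally show ?thesis using ab by simp
qed (use assms in auto)

definition separately_quadratic :: "(real \<Rightarrow> real \<Rightarrow> real) \<Rightarrow> bool" where
  "separately_quadratic f \<longleftrightarrow>
     (\<forall>q\<in>{0..1}. convex_quadratic (\<lambda>p. f p q)) \<and> (\<forall>p\<in>{0..1}. convex_quadratic (f p))"

lemma separately_quadratic_swap:
  "separately_quadratic f \<Longrightarrow> separately_quadratic (\<lambda>p q. f q p)"
  by (simp add: separately_quadratic_def)

lemma separately_quadratic_add:
  "separately_quadratic f \<Longrightarrow> separately_quadratic g \<Longrightarrow> separately_quadratic (\<lambda>p q. f p q + g p q)"
  by (simp add: separately_quadratic_def convex_quadratic_add)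

lemma separately_quadratic_le:
  assumes f: "separately_quadratic f" and "0 \<le> a" "b \<le> 1" "0 \<le> c" "d \<le> 1"
    and p: "p \<in> {a..b}" and q: "q \<in> {c..d}"
    and corners: "f a c \<le> m" "f a d \<le> m" "f b c \<le> m" "f b d \<le> m"
  shows "f p q \<le> m"
proof -
  have "a \<in> {0..1}" "b \<in> {0..1}" "q \<in> {0..1}" using assms by auto
  then have conv: "convex_quadratic (f a)" "convex_quadratic (f b)" "convex_quadratic (\<lambda>p. f p q)"
    using f by (auto simp: separately_quadratic_def)
  have "f a q \<le> m" "f b q \<le> m"
    using convex_quadratic_le[OF conv(1) q] convex_quadratic_le[OF conv(2) q] corners by blast+
  then show ?thesis using convex_quadratic_le[OF conv(3) p] by blast
qed

lemma separately_quadratic_low: "separately_quadratic (low_bound L1 L2)"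
proof -
  obtain U1 W1 U2 W2 where L: "L1 = (U1, W1)" "L2 = (U2, W2)" by fastforce
  have "convex_quadratic (\<lambda>p. low_bound L1 L2 p q)" for q
    by (rule convex_quadraticI[where \<alpha> = 0
          and \<beta> = "10 * (1 - q) * (W1 - U1) + (3 - 10 * q) * (W2 - U2)"
          and \<gamma> = "10 * U1 + (3 - 10 * q) * U2"])
      (simp_all add: low_bound_def L chord_def algebra_simps)
  moreover have "convex_quadratic (low_bound L1 L2 p)" for p
    by (rule convex_quadraticI[where \<alpha> = 0
          and \<beta> = "- 10 * p * (W1 - U1) - 10 * chord U2 W2 p"
          and \<gamma> = "10 * chord U1 W1 p + 3 * chord U2 W2 p"])
      (simp_all add: low_bound_def L chord_def algebra_simps)
  ultimately show ?thesis by (simp add: separately_quadratic_def)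
qed

text \<open>Affine in \<open>p\<close>; in \<open>q\<close> the leading coefficient is nonnegative
  because \<open>U \<le> W\<close> holds for both lines.\<close>

lemma separately_quadratic_high:
  assumes "case_prod bent_line L1" "case_prod bent_line L2"
  shows "separately_quadratic (high_bound L1 L2)"
proof -
  obtain U1 W1 U2 W2 where L: "L1 = (U1, W1)" "L2 = (U2, W2)" by fastforce
  have "convex_quadratic (\<lambda>p. high_bound L1 L2 p q)" for q
    by (rule convex_quadraticI[where \<alpha> = 0
          and \<beta> = "(13 - 10 * q) * (1 - q) * (W1 - U1) + (10 * q - 3) * chord U2 W2 q"
          and \<gamma> = "(13 - 10 * q) * U1"])
      (simp_all add: high_bound_def L chord_def algebra_simps)
  moreover have "convex_quadratic (high_bound L1 L2 p)" if "p \<in> {0..1}" for p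
  proof (rule convex_quadraticI)
    show "high_bound L1 L2 p q = (10 * p * (W1 - U1) + 10 * p * (W2 - U2)) * q\<^sup>2
      + (- 13 * p * (W1 - U1) - 10 * chord U1 W1 p + 10 * p * U2 - 3 * p * (W2 - U2)) * q
      + (13 * chord U1 W1 p - 3 * p * U2)" for q
      by (simp add: high_bound_def L chord_def power2_eq_square algebra_simps)
    show "0 \<le> 10 * p * (W1 - U1) + 10 * p * (W2 - U2)"
      using assms that by (auto simp: L bent_line_def)
  qed
  ultimately show ?thesis by (simp add: separately_quadratic_def)
qed

text \<open>The parameter \<open>c\<close> is the lower end of an interval that does not cross 3/10,
  so it decides which form applies.\<close>

definition line_bound :: "real \<Rightarrow> real \<times> real \<Rightarrow> real \<times> real \<Rightarrow> real \<Rightarrow> real \<Rightarrow> real" where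
  "line_bound c = (if 3/10 \<le> c then high_bound else low_bound)"

text \<open>With tangents fixed for the whole rectangle, \<open>L1\<close> and \<open>L2\<close> for
  \<open>wcost p q\<close> and \<open>L3\<close> and \<open>L4\<close> for \<open>wcost q p\<close>,
  the bound is convex in each variable and four corner values suffice.\<close>

lemma wcost_rectangle:
  assumes lines: "case_prod bent_line L1" "case_prod bent_line L2" "case_prod bent_line L3" "case_prod bent_line L4"
    and rect: "0 \<le> a" "b \<le> 1" "0 \<le> c" "d \<le> 1"
    and ab: "3/10 \<le> a \<or> b \<le> 3/10" and cd: "3/10 \<le> c \<or> d \<le> 3/10"
    and p: "p \<in> {a..b}" and q: "q \<in> {c..d}"
    and corners: "\<forall>p\<in>{a, b}. \<forall>q\<in>{c, d}. line_bound c L1 L2 p q + line_bound a L3 L4 q p \<le> m"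
  shows "wcost p q + wcost q p \<le> m"
proof -
  have "wcost p q \<le> line_bound c L1 L2 p q"
    using wcost_low[of p q L1 L2] wcost_high[of p q L1 L2] rect cd p q lines by (auto simp: line_bound_def)
  moreover have "wcost q p \<le> line_bound a L3 L4 q p"
    using wcost_low[of q p L3 L4] wcost_high[of q p L3 L4] rect ab p q lines by (auto simp: line_bound_def)
  moreover have "separately_quadratic (line_bound c L1 L2)" "separately_quadratic (line_bound a L3 L4)"
    using lines by (auto simp: line_bound_def separately_quadratic_low separately_quadratic_high)
  then have "separately_quadratic (\<lambda>p q. line_bound c L1 L2 p q + line_bound a L3 L4 q p)"
    by (intro separately_quadratic_add[OF _ separately_quadratic_swap])
  then have "line_bound c L1 L2 p q + line_bound a L3 L4 q p \<le> m"
    by (rule separately_quadratic_le[OF _ rect p q]) (use corners in auto)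
  ultimately show ?thesis by linarith
qed

text \<open>Fifteen rectangles, each with its own tangents, cover the triangle
  \<open>q \<le> p\<close>. None crosses 3/10 in either variable, where the form of
  \<open>wcost\<close> changes.\<close>

lemma wcost_le_of_le:
  assumes "0 \<le> q" "q \<le> p" "p \<le> 1"
  shows "wcost p q + wcost q p \<le> 381 / 25"
proof -
  \<comment> \<open>The names give the points of tangency in percent.\<close>
  let ?l10 = "(153/1000, 3322/1000)" and ?l15 = "(235/1000, 2737/1000)" and ?l20 = "(322/1000, 2322/1000)"
    and ?l25 = "(416/1000, 2)" and ?l30 = "(515/1000, 1737/1000)" and ?l40 = "(737/1000, 1322/1000)"
    and ?l50 = "(1, 1)"
  note simps = bent_lines[simplified] line_bound_def low_bound_def high_bound_def chord_def
  have c1: ?thesis if "p \<in> {0..3/10}" "q \<in> {0..3/10}"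
    by (rule wcost_rectangle[OF _ _ _ _ _ _ _ _ _ _ that, of ?l15 ?l15 ?l15 ?l15])
      (simp_all add: simps)
  have c2: ?thesis if "p \<in> {3/10..4/10}" "q \<in> {0..2/10}"
    by (rule wcost_rectangle[OF _ _ _ _ _ _ _ _ _ _ that, of ?l30 ?l40 ?l10 ?l40])
      (simp_all add: simps)
  have c3: ?thesis if "p \<in> {3/10..4/10}" "q \<in> {2/10..3/10}"
    by (rule wcost_rectangle[OF _ _ _ _ _ _ _ _ _ _ that, of ?l25 ?l40 ?l15 ?l40])
      (simp_all add: simps)
  have c4: ?thesis if "p \<in> {3/10..4/10}" "q \<in> {3/10..4/10}"
    by (rule wcost_rectangle[OF _ _ _ _ _ _ _ _ _ _ that, of ?l25 ?l40 ?l25 ?l40])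
      (simp_all add: simps)
  have c5: ?thesis if "p \<in> {4/10..5/10}" "q \<in> {0..2/10}"
    by (rule wcost_rectangle[OF _ _ _ _ _ _ _ _ _ _ that, of ?l40 ?l40 ?l10 ?l40])
      (simp_all add: simps)
  have c6: ?thesis if "p \<in> {5/10..1}" "q \<in> {0..2/10}"
    by (rule wcost_rectangle[OF _ _ _ _ _ _ _ _ _ _ that, of ?l50 ?l50 ?l10 ?l50])
      (simp_all add: simps)
  have c7: ?thesis if "p \<in> {4/10..45/100}" "q \<in> {2/10..3/10}"
    by (rule wcost_rectangle[OF _ _ _ _ _ _ _ _ _ _ that, of ?l30 ?l50 ?l15 ?l50])
      (simp_all add: simps)
  have c8: ?thesis if "p \<in> {45/100..1}" "q \<in> {2/10..3/10}"
    by (rule wcost_rectangle[OF _ _ _ _ _ _ _ _ _ _ that, of ?l40 ?l50 ?l15 ?l50])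
      (simp_all add: simps)
  have c9: ?thesis if "p \<in> {4/10..6/10}" "q \<in> {3/10..35/100}"
    by (rule wcost_rectangle[OF _ _ _ _ _ _ _ _ _ _ that, of ?l30 ?l40 ?l20 ?l50])
      (simp_all add: simps)
  have c10: ?thesis if "p \<in> {4/10..45/100}" "q \<in> {35/100..5/10}"
    by (rule wcost_rectangle[OF _ _ _ _ _ _ _ _ _ _ that, of ?l25 ?l40 ?l25 ?l50])
      (simp_all add: simps)
  have c11: ?thesis if "p \<in> {45/100..6/10}" "q \<in> {35/100..5/10}"
    by (rule wcost_rectangle[OF _ _ _ _ _ _ _ _ _ _ that, of ?l30 ?l50 ?l25 ?l50])
      (simp_all add: simps)
  have c12: ?thesis if "p \<in> {6/10..1}" "q \<in> {3/10..5/10}"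
    by (rule wcost_rectangle[OF _ _ _ _ _ _ _ _ _ _ that, of ?l40 ?l50 ?l15 ?l50])
      (simp_all add: simps)
  have c13: ?thesis if "p \<in> {5/10..7/10}" "q \<in> {5/10..7/10}"
    by (rule wcost_rectangle[OF _ _ _ _ _ _ _ _ _ _ that, of ?l25 ?l50 ?l25 ?l50])
      (simp_all add: simps)
  have c14: ?thesis if "p \<in> {7/10..1}" "q \<in> {5/10..8/10}"
    by (rule wcost_rectangle[OF _ _ _ _ _ _ _ _ _ _ that, of ?l30 ?l50 ?l15 ?l50])
      (simp_all add: simps)
  have c15: ?thesis if "p \<in> {75/100..1}" "q \<in> {8/10..1}"
    by (rule wcost_rectangle[OF _ _ _ _ _ _ _ _ _ _ that, of ?l10 ?l50 ?l15 ?l50])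
      (simp_all add: simps)
  \<comment> \<open>Columns of the cover, each closed at the top by \<open>q \<le> p\<close>; in the
    last one, \<open>q > 8/10\<close> forces \<open>p > 75/100\<close>, as \<open>c15\<close>
    demands.\<close>
  consider "p \<le> 3/10" | "p \<in> {3/10..4/10}" | "p \<in> {4/10..45/100}" | "p \<in> {45/100..5/10}"
    | "p \<in> {5/10..6/10}" | "p \<in> {6/10..7/10}" | "7/10 \<le> p"
    by fastforce
  then show ?thesis
  proof cases
    case 1
    then show ?thesis using assms c1 by simp
  next
    case 2
    then show ?thesis using assms c2 c3 c4
      by (cases "q \<le> 2/10"; cases "q \<le> 3/10"; simp)
  next
    case 3
    then show ?thesis using assms c5 c7 c9 c10
      by (cases "q \<le> 2/10"; cases "q \<le> 3/10"; cases "q \<le> 35/100"; simp)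
  next
    case 4
    then show ?thesis using assms c5 c8 c9 c11
      by (cases "q \<le> 2/10"; cases "q \<le> 3/10"; cases "q \<le> 35/100"; simp)
  next
    case 5
    then show ?thesis using assms c6 c8 c9 c11 c13
      by (cases "q \<le> 2/10"; cases "q \<le> 3/10"; cases "q \<le> 35/100"; cases "q \<le> 5/10"; simp)
  next
    case 6
    then show ?thesis using assms c6 c8 c12 c13
      by (cases "q \<le> 2/10"; cases "q \<le> 3/10"; cases "q \<le> 5/10"; simp)
  next
    case 7
    then show ?thesis using assms c6 c8 c12 c14 c15
      by (cases "q \<le> 2/10"; cases "q \<le> 3/10"; cases "q \<le> 5/10"; cases "q \<le> 8/10"; simp)
  qed
qed

lemma wcost_le:
  assumes "p \<in> {0..1}" "q \<in> {0..1}"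
  shows "wcost p q + wcost q p \<le> 381 / 25"
  using wcost_le_of_le[of q p] wcost_le_of_le[of p q] assms by (cases "q \<le> p") auto

section \<open>Adding the two sides and summing over coordinates\<close>

theorem theorem1p2:
  fixes n :: nat and \<A> \<B> :: "nat set set"
  assumes "n \<ge> 1"
    and "recovering_pair {1..n} \<A> \<B>"
  shows "real (card \<A>) * real (card \<B>) \<le> (2.2543 :: real) ^ n"
proof (cases "\<A> = {} \<or> \<B> = {}")
  case False
  then have ne: "\<A> \<noteq> {}" "\<B> \<noteq> {}" by auto
  define I where "I = {1..n}"
  have I: "finite I" "card I = n" by (simp_all add: I_def)
  have sub: "\<A> \<subseteq> Pow I" "\<B> \<subseteq> Pow I"
    using assms(2) by (simp_all add: recovering_pair_def I_def)
  have recA: "\<forall>A\<in>\<A>. \<forall>A'\<in>\<A>. \<forall>B\<in>\<B>. \<forall>B'\<in>\<B>. A - B = A' - B' \<longrightarrow> A = A'"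
    and recB: "\<forall>B\<in>\<B>. \<forall>B'\<in>\<B>. \<forall>A\<in>\<A>. \<forall>A'\<in>\<A>. B - A = B' - A' \<longrightarrow> B = B'"
    using assms(2) unfolding recovering_pair_def by meson+
  have fin: "finite \<A>" "finite \<B>" using sub I(1) by (meson finite_Pow_iff finite_subset)+
  define p q where "p = freq \<A>" and "q = freq \<B>"
  have p01: "p i \<in> {0..1}" and q01: "q i \<in> {0..1}" for i
    unfolding p_def q_def by (rule freq_in_unit, rule fin)+
  define s t where "s = (\<lambda>i. max 0 (10 * q i - 3))" and "t = (\<lambda>i. max 0 (10 * p i - 3))"
  \<comment> \<open>Each base is ordered by the frequencies of the other family: \<open>x\<close> is
    tight on level sets of \<open>s\<close>, which comes from \<open>q\<close>, and \<open>y\<close>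
    on those of \<open>t\<close>, which comes from \<open>p\<close>.\<close>
  obtain x where x: "\<And>S. S \<subseteq> I \<Longrightarrow> sum x S \<le> tent \<A> S"
    "\<And>c. sum x {i\<in>I. c \<le> s i} = tent \<A> {i\<in>I. c \<le> s i}" "sum x I = tent \<A> I"
    using greedy_base[OF I(1) tent_empty tent_submodular[OF fin(1)]] by metis
  obtain y where y: "\<And>S. S \<subseteq> I \<Longrightarrow> sum y S \<le> tent \<B> S"
    "\<And>c. sum y {i\<in>I. c \<le> t i} = tent \<B> {i\<in>I. c \<le> t i}" "sum y I = tent \<B> I"
    using greedy_base[OF I(1) tent_empty tent_submodular[OF fin(2)]] by metis
  have x_le: "x i \<le> bent (p i)" and y_le: "y i \<le> bent (q i)" if "i \<in> I" for i
    using x(1)[of "{i}"] y(1)[of "{i}"] that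
    by (simp_all add: p_def q_def tent_singleton[OF fin(1) ne(1)] tent_singleton[OF fin(2) ne(2)])
  have X: "sum x I = log 2 (card \<A>)" and Y: "sum y I = log 2 (card \<B>)"
    using x(3) y(3) sub by (simp_all add: tent_Union)
  have s: "0 \<le> s i \<and> s i \<le> 10" and t: "0 \<le> t i \<and> t i \<le> 10" for i
    using p01[of i] q01[of i] by (auto simp: s_def t_def)
  have "10 * (sum x I + (\<Sum>i\<in>I. p i * y i))
      \<le> (\<Sum>i\<in>I. (10 - s i) * bent (p i * (1 - q i)) + s i * (x i + p i * bent (q i)))"
    using weighted_side_bound[OF fin ne I(1) sub(1) recA x(2) y(1) s] by (simp add: X p_def q_def)
  moreover have "10 * (sum y I + (\<Sum>i\<in>I. q i * x i))
      \<le> (\<Sum>i\<in>I. (10 - t i) * bent (q i * (1 - p i)) + t i * (y i + q i * bent (p i)))"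
    using weighted_side_bound[OF fin(2,1) ne(2,1) I(1) sub(2) recB y(2) x(1) t] by (simp add: Y p_def q_def)
  \<comment> \<open>The coefficient of \<open>x i\<close> collects \<open>s i\<close> from this
    side, \<open>- 10 * q i\<close> moved over from the other side's bound, and 3 added on both
    sides, whence \<open>13 = 10 + 3\<close>.\<close>
  moreover have "(\<Sum>i\<in>I. (10 - s i) * bent (p i * (1 - q i)) + s i * (p i * bent (q i)) + (s i + 3 - 10 * q i) * x i)
      = (\<Sum>i\<in>I. (10 - s i) * bent (p i * (1 - q i)) + s i * (x i + p i * bent (q i)))
        + 3 * sum x I - 10 * (\<Sum>i\<in>I. q i * x i)"
    unfolding sum_distrib_left sum.distrib[symmetric] sum_subtractf[symmetric]
    by (intro sum.cong refl) (simp add: algebra_simps)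
  moreover have "(\<Sum>i\<in>I. (10 - t i) * bent (q i * (1 - p i)) + t i * (q i * bent (p i)) + (t i + 3 - 10 * p i) * y i)
      = (\<Sum>i\<in>I. (10 - t i) * bent (q i * (1 - p i)) + t i * (y i + q i * bent (p i)))
        + 3 * sum y I - 10 * (\<Sum>i\<in>I. p i * y i)"
    unfolding sum_distrib_left sum.distrib[symmetric] sum_subtractf[symmetric]
    by (intro sum.cong refl) (simp add: algebra_simps)
  ultimately have "13 * (sum x I + sum y I)
      \<le> (\<Sum>i\<in>I. (10 - s i) * bent (p i * (1 - q i)) + s i * (p i * bent (q i)) + (s i + 3 - 10 * q i) * x i)
      + (\<Sum>i\<in>I. (10 - t i) * bent (q i * (1 - p i)) + t i * (q i * bent (p i)) + (t i + 3 - 10 * p i) * y i)"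
    by argo
  also have "\<dots> \<le> (\<Sum>i\<in>I. wcost (p i) (q i)) + (\<Sum>i\<in>I. wcost (q i) (p i))"
  proof (intro add_mono sum_mono)
    fix i assume i: "i \<in> I"
    \<comment> \<open>The weights are chosen so that these coefficients are nonnegative, which
      permits replacing \<open>x i\<close> and \<open>y i\<close> by their upper bounds.\<close>
    have coeff: "s i + 3 - 10 * q i = max 0 (3 - 10 * q i)" "t i + 3 - 10 * p i = max 0 (3 - 10 * p i)"
      by (auto simp: s_def t_def max_def)
    have "(s i + 3 - 10 * q i) * x i \<le> max 0 (3 - 10 * q i) * bent (p i)"
      unfolding coeff using x_le[OF i] by (intro mult_left_mono) auto
    then show "(10 - s i) * bent (p i * (1 - q i)) + s i * (p i * bent (q i)) + (s i + 3 - 10 * q i) * x i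
        \<le> wcost (p i) (q i)"
      by (simp add: wcost_def s_def)
    have "(t i + 3 - 10 * p i) * y i \<le> max 0 (3 - 10 * p i) * bent (q i)"
      unfolding coeff using y_le[OF i] by (intro mult_left_mono) auto
    then show "(10 - t i) * bent (q i * (1 - p i)) + t i * (q i * bent (p i)) + (t i + 3 - 10 * p i) * y i
        \<le> wcost (q i) (p i)"
      by (simp add: wcost_def t_def)
  qed
  also have "\<dots> = (\<Sum>i\<in>I. wcost (p i) (q i) + wcost (q i) (p i))"
    by (simp add: sum.distrib)
  also have "\<dots> \<le> (\<Sum>i\<in>I. 381 / 25)"
    by (intro sum_mono wcost_le p01 q01)
  also have "\<dots> = 13 * (n * (381 / 325))"
    by (simp add: I(2))
  finally have "log 2 (card \<A>) + log 2 (card \<B>) \<le> n * (381 / 325)"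
    by (simp add: X Y)
  also have "\<dots> \<le> n * log 2 2.2543"
  proof (rule mult_left_mono)
    \<comment> \<open>A fraction with small denominator between \<open>381 / 325\<close>, which is
      \<open>15.24 / 13\<close>, and the logarithm.\<close>
    have "34 / 29 \<le> log 2 (2.2543 :: real)"
      using log2_ge[of "2.2543" 29 34] by (simp add: power_divide le_divide_eq)
    then show "381 / 325 \<le> log 2 (2.2543 :: real)" by simp
  qed simp
  also have "\<dots> = log 2 (2.2543 ^ n)"
    by (simp add: log_nat_power)
  finally have "log 2 (real (card \<A>) * real (card \<B>)) \<le> log 2 (2.2543 ^ n)"
    using fin ne by (simp add: log_mult card_gt_0_iff)
  then show ?thesis
    using fin ne by (subst (asm) log_le_cancel_iff) (auto simp: card_gt_0_iff)
qed auto

end
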